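(* Let $n\ge1$ and let $\mathbb H^n$ be the Heisenberg group, with group identity $e$, left-invariant horizontal vector fields $X_1,\dots,X_{2n}$, horizontal Laplacian $\Delta_H=\sum_{i=1}^{2n}X_i^2$, left-invariant carré du champ $|\nabla_H f|^2=\sum_{i=1}^{2n}(X_if)^2$, and balls $B_r=\{p\in\mathbb H^n\mid\rho(p)<r\}$, where $\rho$ is a fixed homogeneous norm on $\mathbb H^n$. Then there exist $r>0$ and a real-valued function $f\in C^2(B_r)$ that is not linear on $B_r$ (i.e. $f$ is not of the form $f(p)=\alpha+\langle\omega,z\rangle$ with $\alpha\in\mathbb R$, $\omega\in\mathbb R^{2n}$), such that $\Delta_H f=0$ in $B_r$, $|\nabla_H f(e)|^2=1$, and $|\nabla_H f|^2\le1$ in $B_r$.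
   Context: The Heisenberg group $\mathbb H^n$ is $\mathbb R^{2n+1}$ with (logarithmic) coordinates $p=(z,\sigma)$, $z=(x,y)\in\mathbb R^n\times\mathbb R^n$, $\sigma\in\mathbb R$, with group law $$(x,y,\sigma)\circ(x',y',\sigma')=\Big(x+x',\,y+y',\,\sigma+\sigma'+\tfrac12\big(\langle x,y'\rangle-\langle y,x'\rangle\big)\Big),$$ and identity $e=(0,0,0)$. It is a Carnot group of step $2$. Its left-invariant horizontal vector fields are, for $i=1,\dots,n$, $$X_i=\partial_{x_i}-\frac{y_i}{2}\partial_\sigma,\qquad X_{n+i}=\partial_{y_i}+\frac{x_i}{2}\partial_\sigma .$$ The dilations are $\delta_\lambda(x,y,\sigma)=(\lambda x,\lambda y,\lambda^2\sigma)$, $\lambda>0$. A homogeneous norm is a continuous function $\rho:\mathbb H^n\to[0,\infty)$, $C^\infty$ on $\mathbb H^n\setminus\{e\}$, such that $\rho(p^{-1})=\rho(p)$, $\rho(\delta_\lambda p)=\lambda\rho(p)$ for all $\lambda>0$, and $\rho(p)=0$ if and only if $p=e$. In a Carnot group, a linear function, in the convention used here, is one of the form $f(p)=\alpha+\langle\omega,z\rangle$ with $\alpha$ a real constant and $\omega$ a constant vector, $z$ being the horizontal variables (it does not depend on $\sigma$). *)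

theory Defs
  imports "HOL-Analysis.Analysis"
begin

text \<open>
  The Heisenberg group, with \<open>n = CARD('n)\<close>: points are \<open>(x, y, \<sigma>)\<close> in logarithmic coordinates.
  The topology and the differentiable structure are those of the underlying Euclidean space;
  the operations \<open>+\<close> and \<open>0\<close> of the product type are the Euclidean ones, not the group ones.
\<close>

type_synonym 'n heis = "(real^'n) \<times> (real^'n) \<times> real"

definition heis_mult :: "'n::finite heis \<Rightarrow> 'n heis \<Rightarrow> 'n heis" where
  "heis_mult = (\<lambda>(x, y, s) (x', y', s'). (x + x', y + y', s + s' + (1/2) * (x \<bullet> y' - y \<bullet> x')))"

definition heis_e :: "'n::finite heis" where
  "heis_e = (0, 0, 0)"

definition heis_inv :: "'n::finite heis \<Rightarrow> 'n heis" where
  "heis_inv = (\<lambda>(x, y, s). (- x, - y, - s))"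

lemma heis_mult_assoc: "heis_mult (heis_mult p q) r = heis_mult p (heis_mult q r)"
  by (cases p; cases q; cases r)
    (simp add: heis_mult_def inner_add_left inner_add_right algebra_simps add_divide_distrib)

lemma heis_mult_e: "heis_mult heis_e p = p" "heis_mult p heis_e = p"
  by (cases p; simp add: heis_mult_def heis_e_def)+

lemma heis_mult_inv: "heis_mult (heis_inv p) p = heis_e" "heis_mult p (heis_inv p) = heis_e"
  by (cases p; simp add: heis_mult_def heis_e_def heis_inv_def inner_commute)+

definition heis_dilation :: "real \<Rightarrow> 'n::finite heis \<Rightarrow> 'n heis" where
  "heis_dilation l = (\<lambda>(x, y, s). (l *\<^sub>R x, l *\<^sub>R y, l\<^sup>2 * s))"

text \<open>
  \<open>Ck_on k f S\<close>: \<open>f\<close> is of class \<open>C\<^sup>k\<close> on \<open>S\<close>. It is meant for open \<open>S\<close> only, since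
  differentiability at a point of \<open>S\<close> is that of the unrestricted function.
\<close>

fun Ck_on :: "nat \<Rightarrow> ('a::euclidean_space \<Rightarrow> real) \<Rightarrow> 'a set \<Rightarrow> bool" where
  "Ck_on 0 f S \<longleftrightarrow> continuous_on S f"
| "Ck_on (Suc k) f S \<longleftrightarrow> (\<forall>p\<in>S. f differentiable (at p)) \<and>
      (\<forall>v. Ck_on k (\<lambda>p. frechet_derivative f (at p) v) S)"

definition smooth_on :: "('a::euclidean_space \<Rightarrow> real) \<Rightarrow> 'a set \<Rightarrow> bool" where
  "smooth_on f S \<longleftrightarrow> (\<forall>k. Ck_on k f S)"

definition homogeneous_norm :: "('n::finite heis \<Rightarrow> real) \<Rightarrow> bool" where
  "homogeneous_norm \<rho> \<longleftrightarrow>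
     (\<forall>p. 0 \<le> \<rho> p) \<and> continuous_on UNIV \<rho> \<and> smooth_on \<rho> (UNIV - {heis_e}) \<and>
     (\<forall>p. \<rho> (heis_inv p) = \<rho> p) \<and>
     (\<forall>l>0. \<forall>p. \<rho> (heis_dilation l p) = l * \<rho> p) \<and>
     (\<forall>p. \<rho> p = 0 \<longleftrightarrow> p = heis_e)"

definition heis_ball :: "('n::finite heis \<Rightarrow> real) \<Rightarrow> real \<Rightarrow> 'n heis set" where
  "heis_ball \<rho> r = {p. \<rho> p < r}"

definition d_x :: "'n::finite \<Rightarrow> ('n heis \<Rightarrow> real) \<Rightarrow> 'n heis \<Rightarrow> real" where
  "d_x i f p = frechet_derivative f (at p) (axis i 1, 0, 0)"

definition d_y :: "'n::finite \<Rightarrow> ('n heis \<Rightarrow> real) \<Rightarrow> 'n heis \<Rightarrow> real" where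
  "d_y i f p = frechet_derivative f (at p) (0, axis i 1, 0)"

definition d_sigma :: "('n::finite heis \<Rightarrow> real) \<Rightarrow> 'n heis \<Rightarrow> real" where
  "d_sigma f p = frechet_derivative f (at p) (0, 0, 1)"

text \<open>
  The \<open>2n\<close> horizontal fields are indexed by \<open>'n + 'n\<close>: \<open>Inl i\<close> stands for the index \<open>i\<close> and
  \<open>Inr i\<close> for the index \<open>n + i\<close>.
\<close>

fun hfield :: "'n::finite + 'n \<Rightarrow> ('n heis \<Rightarrow> real) \<Rightarrow> 'n heis \<Rightarrow> real" where
  "hfield (Inl i) f (x, y, s) = d_x i f (x, y, s) - (y $ i) / 2 * d_sigma f (x, y, s)"
| "hfield (Inr i) f (x, y, s) = d_y i f (x, y, s) + (x $ i) / 2 * d_sigma f (x, y, s)"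

definition hlaplacian :: "('n::finite heis \<Rightarrow> real) \<Rightarrow> 'n heis \<Rightarrow> real" where
  "hlaplacian f p = (\<Sum>i\<in>UNIV. hfield i (hfield i f) p)"

definition carre_du_champ :: "('n::finite heis \<Rightarrow> real) \<Rightarrow> 'n heis \<Rightarrow> real" where
  "carre_du_champ f p = (\<Sum>i\<in>UNIV. (hfield i f p)\<^sup>2)"

text \<open>
  Linear functions in the sense of Carnot groups: affine in the horizontal variables \<open>z = (x, y)\<close>
  and independent of \<open>\<sigma>\<close>.
\<close>

definition heis_linear_on :: "'n::finite heis set \<Rightarrow> ('n heis \<Rightarrow> real) \<Rightarrow> bool" where
  "heis_linear_on S f \<longleftrightarrow>
     (\<exists>\<alpha>. \<exists>\<omega> :: (real^'n) \<times> (real^'n). \<forall>(x, y, s)\<in>S. f (x, y, s) = \<alpha> + \<omega> \<bullet> (x, y))"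

end

theory Submission
  imports Defs
begin

text \<open>
  For \<open>n = 1\<close> start from the linear function \<open>x\<close>. The cubic harmonic polynomial
  \<open>P = 2\<sigma>y - x\<^sup>3/3\<close> has \<open>X P = -(x\<^sup>2 + y\<^sup>2)\<close>, so that the carre du champ of \<open>x + P\<close> decreases in
  the horizontal directions, but \<open>Y P = 2\<sigma> + x y\<close> contributes \<open>4\<sigma>\<^sup>2\<close>. A harmonic quintic
  polynomial with leading term \<open>-4\<sigma>\<^sup>2x\<close> has \<open>X\<close>-derivative \<open>-4\<sigma>\<^sup>2 + \<dots>\<close> and compensates this:
  the carre du champ becomes \<open>1 - 2(x\<^sup>2 + y\<^sup>2) - 4\<sigma>\<^sup>2\<close> up to terms that are negligible near \<open>e\<close>.
  For general \<open>n\<close>, apply this in one pair of variables \<open>(x\<^sub>k, y\<^sub>k)\<close>; harmonicity is restored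
  by a term \<open>x\<^sub>k\<^sup>3|z|\<^sup>2/3\<close> and a change of the coefficient of \<open>x\<^sub>k\<^sup>5\<close>.
\<close>

section \<open>Functions of class \<open>C\<^sup>k\<close>\<close>

lemma Ck_on_mono:
  assumes "Ck_on k f S" "T \<subseteq> S"
  shows "Ck_on k f T"
  using assms
proof (induction k arbitrary: f)
  case 0
  then show ?case using continuous_on_subset by auto
next
  case (Suc k)
  then show ?case by auto
qed

lemma Ck_on_Suc_imp: "Ck_on (Suc k) f S \<Longrightarrow> Ck_on k f S"
proof (induction k arbitrary: f)
  case 0
  then show ?case
    by (auto intro!: continuous_at_imp_continuous_on differentiable_imp_continuous_within)
next
  case (Suc k)
  then show ?case by (metis Ck_on.simps(2))
qed

lemma Ck_on_const: "Ck_on k (\<lambda>p. c) S"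
proof (induction k arbitrary: c)
  case (Suc k)
  then show ?case by (simp add: frechet_derivative_const)
qed simp

lemma Ck_on_bounded_linear:
  assumes "bounded_linear f"
  shows "Ck_on k f S"
proof (cases k)
  case 0
  then show ?thesis using linear_continuous_on[OF assms] by simp
next
  case (Suc j)
  have d: "(f has_derivative f) (at p)" for p
    using bounded_linear_imp_has_derivative[OF assms] .
  then have "frechet_derivative f (at p) = f" for p
    by (rule frechet_derivative_at[symmetric])
  then show ?thesis using d Suc by (auto simp: differentiable_def Ck_on_const)
qed

text \<open>On \<open>UNIV\<close> the formula for the derivative is an identity at every point, so
  it rewrites under the abstraction over \<open>p\<close> without a congruence argument;
  \<open>Ck_on_mono\<close> restricts to the ball at the end.\<close>

lemma Ck_on_add:
  assumes "Ck_on k f UNIV" "Ck_on k g UNIV"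
  shows "Ck_on k (\<lambda>p. f p + g p) UNIV"
  using assms
proof (induction k arbitrary: f g)
  case 0
  then show ?case by (simp add: continuous_on_add)
next
  case (Suc k)
  have df: "f differentiable at p" and dg: "g differentiable at p" for p
    using Suc.prems by auto
  have "((\<lambda>p. f p + g p) has_derivative
      (\<lambda>v. frechet_derivative f (at p) v + frechet_derivative g (at p) v)) (at p)" for p
    using df dg by (intro has_derivative_add) (simp_all add: frechet_derivative_works[symmetric])
  then have "frechet_derivative (\<lambda>p. f p + g p) (at p)
      = (\<lambda>v. frechet_derivative f (at p) v + frechet_derivative g (at p) v)" for p
    by (rule frechet_derivative_at[symmetric])
  then show ?case using Suc df dg by simp
qed

lemma Ck_on_mult:
  assumes "Ck_on k f UNIV" "Ck_on k g UNIV"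
  shows "Ck_on k (\<lambda>p. f p * g p) UNIV"
  using assms
proof (induction k arbitrary: f g)
  case 0
  then show ?case by (simp add: continuous_on_mult)
next
  case (Suc k)
  have df: "f differentiable at p" and dg: "g differentiable at p" for p
    using Suc.prems by auto
  have "((\<lambda>p. f p * g p) has_derivative
      (\<lambda>v. f p * frechet_derivative g (at p) v + frechet_derivative f (at p) v * g p)) (at p)" for p
    using df dg by (intro has_derivative_mult) (simp_all add: frechet_derivative_works[symmetric])
  then have "frechet_derivative (\<lambda>p. f p * g p) (at p)
      = (\<lambda>v. f p * frechet_derivative g (at p) v + frechet_derivative f (at p) v * g p)" for p
    by (rule frechet_derivative_at[symmetric])
  \<comment> \<open>The product rule pairs each factor with a derivative of the other, so the
    factors themselves are lowered from class \<open>C^(k+1)\<close> to \<open>C^k\<close>.\<close>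
  moreover have "Ck_on k (\<lambda>p. f p * frechet_derivative g (at p) v
      + frechet_derivative f (at p) v * g p) UNIV" for v
    using Suc.prems Ck_on_Suc_imp[OF Suc.prems(1)] Ck_on_Suc_imp[OF Suc.prems(2)]
    by (intro Ck_on_add Suc.IH) auto
  ultimately show ?case using df dg by auto
qed

lemma Ck_on_sum:
  assumes "\<And>i. i \<in> I \<Longrightarrow> Ck_on k (f i) UNIV"
  shows "Ck_on k (\<lambda>p. \<Sum>i\<in>I. f i p) UNIV"
  using assms by (induction I rule: infinite_finite_induct) (simp_all add: Ck_on_const Ck_on_add)

lemma Ck_on_power: "Ck_on k f UNIV \<Longrightarrow> Ck_on k (\<lambda>p. f p ^ m) UNIV"
  by (induction m) (simp_all add: Ck_on_const Ck_on_mult)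

section \<open>Horizontal derivatives\<close>

text \<open>By linearity of the total derivative, a horizontal field differentiates along a single
  tangent vector; any derivative \<open>D\<close> at hand then replaces the separate partial
  derivatives.\<close>

lemma
  assumes "(f has_derivative D) (at (x, y, s))"
  shows hfield_Inl_eq: "hfield (Inl i) f (x, y, s) = D (axis i 1, 0, - (y $ i) / 2)"
    and hfield_Inr_eq: "hfield (Inr i) f (x, y, s) = D (0, axis i 1, (x $ i) / 2)"
proof -
  have D: "frechet_derivative f (at (x, y, s)) = D"
    using frechet_derivative_at[OF assms] by simp
  have lin: "linear D"
    using assms has_derivative_linear by blast
  have "D (axis i 1, 0, - (y $ i) / 2) = D ((axis i 1, 0, 0) + (- (y $ i) / 2) *\<^sub>R (0, 0, 1))"
    by simp
  also have "\<dots> = D (axis i 1, 0, 0) + (- (y $ i) / 2) *\<^sub>R D (0, 0, 1)"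
    by (simp only: linear_add[OF lin] linear_scale[OF lin])
  finally show "hfield (Inl i) f (x, y, s) = D (axis i 1, 0, - (y $ i) / 2)"
    by (simp add: d_x_def d_sigma_def D)
  have "D (0, axis i 1, (x $ i) / 2) = D ((0, axis i 1, 0) + ((x $ i) / 2) *\<^sub>R (0, 0, 1))"
    by simp
  also have "\<dots> = D (0, axis i 1, 0) + ((x $ i) / 2) *\<^sub>R D (0, 0, 1)"
    by (simp only: linear_add[OF lin] linear_scale[OF lin])
  finally show "hfield (Inr i) f (x, y, s) = D (0, axis i 1, (x $ i) / 2)"
    by (simp add: d_y_def d_sigma_def D)
qed

lemma sum_UNIV_Plus:
  fixes g :: "'a::finite + 'b::finite \<Rightarrow> 'c::comm_monoid_add"
  shows "(\<Sum>i\<in>UNIV. g i) = (\<Sum>i\<in>UNIV. g (Inl i)) + (\<Sum>i\<in>UNIV. g (Inr i))"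
  by (simp add: UNIV_Plus_UNIV[symmetric] sum.Plus del: UNIV_Plus_UNIV)

section \<open>The harmonic polynomial\<close>

text \<open>The terms have degrees 1, 3 and 5 under the dilations, and each degree is harmonic
  separately. In degree 5 the Laplacian of \<open>-4 * s^2 * x\<close> is
  \<open>8*s*y - 2*R*x\<close>. The term in \<open>s*x^2*y\<close> cancels \<open>8*s*y\<close> but
  creates \<open>8*x*y^2\<close>, which the term in \<open>x^3*y^2\<close> removes;
  \<open>(1/3)*R*x^3\<close> cancels \<open>-2*R*x\<close>. There remains
  \<open>(4/3)*(n-2)*x^3\<close>, which fixes the coefficient of \<open>x^5\<close>.\<close>

definition quintic :: "'n::finite \<Rightarrow> 'n heis \<Rightarrow> real" where
  "quintic k p = (let x = fst p $ k; y = fst (snd p) $ k; s = snd (snd p);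
      R = fst p \<bullet> fst p + fst (snd p) \<bullet> fst (snd p) in
    x + 2 * s * y - (1/3) * x^3 - 4 * s^2 * x - 4 * s * x^2 * y - (4/3) * x^3 * y^2
      + (1/3) * R * x^3 - ((real CARD('n) - 2) / 15) * x^5)"

text \<open>The Euclidean partial derivatives of \<^term>\<open>quintic k\<close>, apart from the contribution of \<open>R\<close>.\<close>

definition quintic_x :: "'n::finite \<Rightarrow> 'n heis \<Rightarrow> real" where
  "quintic_x k p = (let x = fst p $ k; y = fst (snd p) $ k; s = snd (snd p);
      R = fst p \<bullet> fst p + fst (snd p) \<bullet> fst (snd p) in
    1 - x^2 - 4 * s^2 - 8 * s * x * y - 4 * x^2 * y^2 + R * x^2 - ((real CARD('n) - 2) / 3) * x^4)"

definition quintic_y :: "'n::finite \<Rightarrow> 'n heis \<Rightarrow> real" where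
  "quintic_y k p = (let x = fst p $ k; y = fst (snd p) $ k; s = snd (snd p) in
    2 * s - 4 * s * x^2 - (8/3) * x^3 * y)"

definition quintic_s :: "'n::finite \<Rightarrow> 'n heis \<Rightarrow> real" where
  "quintic_s k p = (let x = fst p $ k; y = fst (snd p) $ k; s = snd (snd p) in
    2 * y - 8 * s * x - 4 * x^2 * y)"

lemma Ck_on_quintic: "Ck_on m (quintic (k :: 'n::finite)) UNIV"
proof -
  have x: "Ck_on m (\<lambda>p :: 'n heis. fst p $ i) UNIV"
    and y: "Ck_on m (\<lambda>p :: 'n heis. fst (snd p) $ i) UNIV"
    and s: "Ck_on m (\<lambda>p :: 'n heis. snd (snd p)) UNIV" for i
    by (intro Ck_on_bounded_linear bounded_linear_intros
        bounded_linear_compose[OF bounded_linear_vec_nth])+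
  \<comment> \<open>Differences become sums with negative coefficients and \<open>R\<close> a sum
    over coordinates, so that closure under sums, products and powers suffices.\<close>
  have "quintic k = (\<lambda>p. fst p $ k + 2 * snd (snd p) * fst (snd p) $ k + (-1/3) * (fst p $ k)^3
      + (-4) * (snd (snd p))^2 * fst p $ k + (-4) * snd (snd p) * (fst p $ k)^2 * fst (snd p) $ k
      + (-4/3) * (fst p $ k)^3 * (fst (snd p) $ k)^2
      + (1/3) * ((\<Sum>i\<in>UNIV. fst p $ i * fst p $ i) + (\<Sum>i\<in>UNIV. fst (snd p) $ i * fst (snd p) $ i))
        * (fst p $ k)^3
      + (- (real CARD('n) - 2) / 15) * (fst p $ k)^5)"
    by (rule ext) (simp add: quintic_def Let_def inner_vec_def field_simps)
  then show ?thesis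
    by (simp only:) (intro Ck_on_add Ck_on_mult Ck_on_power Ck_on_sum Ck_on_const x y s)
qed

section \<open>First and second derivatives of the polynomial\<close>

lemma has_derivative_coords:
  "((\<lambda>p. fst p $ k) has_derivative (\<lambda>v. fst v $ k)) F"
  "((\<lambda>p. fst (snd p) $ k) has_derivative (\<lambda>v. fst (snd v) $ k)) F"
  "((\<lambda>p. fst p) has_derivative (\<lambda>v. fst v)) F"
  "((\<lambda>p. fst (snd p)) has_derivative (\<lambda>v. fst (snd v))) F"
  "((\<lambda>p. snd (snd p)) has_derivative (\<lambda>v. snd (snd v))) F"
  by (intro bounded_linear_imp_has_derivative bounded_linear_intros
      bounded_linear_compose[OF bounded_linear_vec_nth])+

text \<open>The derivative of \<open>R\<close> involves all coordinates and is kept as an inner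
  product; on an axis vector it reduces to one coordinate of \<open>p\<close>.\<close>

lemma has_derivative_quintic:
  "(quintic k has_derivative
     (\<lambda>v. quintic_x k p * fst v $ k + quintic_y k p * fst (snd v) $ k
        + (2/3) * (fst p $ k)^3 * (fst p \<bullet> fst v + fst (snd p) \<bullet> fst (snd v))
        + quintic_s k p * snd (snd v))) (at p)"
  unfolding quintic_def Let_def
  by (rule has_derivative_eq_rhs,
      (rule has_derivative_const has_derivative_coords has_derivative_add has_derivative_diff
      has_derivative_mult has_derivative_power has_derivative_inner)+,
      rule ext, simp add: quintic_x_def quintic_y_def quintic_s_def Let_def inner_commute field_simps eval_nat_numeral)

lemma has_derivative_quintic_x:
  fixes k :: "'n::finite" and p :: "'n heis"
  defines "x \<equiv> fst p $ k" and "y \<equiv> fst (snd p) $ k" and "s \<equiv> snd (snd p)"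
    and "R \<equiv> fst p \<bullet> fst p + fst (snd p) \<bullet> fst (snd p)"
  shows "(quintic_x k has_derivative
     (\<lambda>v. (- 2 * x - 8 * s * y - 8 * x * y^2 + 2 * R * x - (4 * (real CARD('n) - 2) / 3) * x^3)
          * fst v $ k
        + (- 8 * s * x - 8 * x^2 * y) * fst (snd v) $ k
        + 2 * x^2 * (fst p \<bullet> fst v + fst (snd p) \<bullet> fst (snd v))
        + (- 8 * s - 8 * x * y) * snd (snd v))) (at p)"
  unfolding quintic_x_def Let_def
  by (rule has_derivative_eq_rhs,
      (rule has_derivative_const has_derivative_coords has_derivative_add has_derivative_diff
      has_derivative_mult has_derivative_power has_derivative_inner)+,
      rule ext, simp add: x_def y_def s_def R_def inner_commute field_simps eval_nat_numeral)

lemma has_derivative_quintic_y: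
  fixes k :: "'n::finite" and p :: "'n heis"
  defines "x \<equiv> fst p $ k" and "y \<equiv> fst (snd p) $ k" and "s \<equiv> snd (snd p)"
  shows "(quintic_y k has_derivative
     (\<lambda>v. (- 8 * s * x - 8 * x^2 * y) * fst v $ k - (8/3) * x^3 * fst (snd v) $ k
        + (2 - 4 * x^2) * snd (snd v))) (at p)"
  unfolding quintic_y_def Let_def
  by (rule has_derivative_eq_rhs,
      (rule has_derivative_const has_derivative_coords has_derivative_add has_derivative_diff
      has_derivative_mult has_derivative_power has_derivative_inner)+,
      rule ext, simp add: x_def y_def s_def field_simps eval_nat_numeral)

lemma has_derivative_quintic_s:
  fixes k :: "'n::finite" and p :: "'n heis"
  defines "x \<equiv> fst p $ k" and "y \<equiv> fst (snd p) $ k" and "s \<equiv> snd (snd p)"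
  shows "(quintic_s k has_derivative
     (\<lambda>v. (- 8 * s - 8 * x * y) * fst v $ k + (2 - 4 * x^2) * fst (snd v) $ k
        - 8 * x * snd (snd v))) (at p)"
  unfolding quintic_s_def Let_def
  by (rule has_derivative_eq_rhs,
      (rule has_derivative_const has_derivative_coords has_derivative_add has_derivative_diff
      has_derivative_mult has_derivative_power has_derivative_inner)+,
      rule ext, simp add: x_def y_def s_def field_simps eval_nat_numeral)

lemma axis_nth_if: "axis i (1::real) $ k = of_bool (i = k)"
  by (simp add: axis_def)

lemma hfield_Inl_quintic:
  "hfield (Inl i) (quintic k) p = of_bool (i = k) * quintic_x k p
     + (2/3) * (fst p $ k)^3 * fst p $ i - fst (snd p) $ i / 2 * quintic_s k p"
proof -
  obtain x y s where p: "p = (x, y, s)" by (cases p)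
  show ?thesis
    unfolding p hfield_Inl_eq[OF has_derivative_quintic]
    by (simp add: inner_axis axis_nth_if)
qed

lemma hfield_Inr_quintic:
  "hfield (Inr i) (quintic k) p = of_bool (i = k) * quintic_y k p
     + (2/3) * (fst p $ k)^3 * fst (snd p) $ i + fst p $ i / 2 * quintic_s k p"
proof -
  obtain x y s where p: "p = (x, y, s)" by (cases p)
  show ?thesis
    unfolding p hfield_Inr_eq[OF has_derivative_quintic]
    by (simp add: inner_axis axis_nth_if)
qed

text \<open>The terms in \<open>s\<close> cancel within each single second derivative. The rest
  splits into a part present only for \<open>i = k\<close> and a part that sees \<open>i\<close>
  only through \<open>(y $ i)^2\<close>, ready for summation.\<close>

lemma hfield_Inl_hfield_Inl_quintic:
  fixes k i :: "'n::finite" and x y :: "real^'n"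
  defines "a \<equiv> x $ k" and "b \<equiv> y $ k" and "R \<equiv> x \<bullet> x + y \<bullet> y"
  shows "hfield (Inl i) (hfield (Inl i) (quintic k)) (x, y, s)
    = of_bool (i = k) * (- 2 * a - 8 * a * b^2 + 2 * R * a
        - (4 * (real CARD('n) - 2) / 3) * a^3 + 4 * a^3 + 8 * a * b^2)
      + (2/3) * a^3 - 2 * a * (y $ i)^2"
proof -
  have "(hfield (Inl i) (quintic k) has_derivative
     (\<lambda>v. of_bool (i = k) * ((- 2 * a - 8 * s * b - 8 * a * b^2 + 2 * R * a
            - (4 * (real CARD('n) - 2) / 3) * a^3) * fst v $ k
          + (- 8 * s * a - 8 * a^2 * b) * fst (snd v) $ k
          + 2 * a^2 * (x \<bullet> fst v + y \<bullet> fst (snd v))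
          + (- 8 * s - 8 * a * b) * snd (snd v))
        + 2 * a^2 * x $ i * fst v $ k + (2/3) * a^3 * fst v $ i
        - (1/2) * fst (snd v) $ i * quintic_s k (x, y, s)
        - y $ i / 2 * ((- 8 * s - 8 * a * b) * fst v $ k + (2 - 4 * a^2) * fst (snd v) $ k
          - 8 * a * snd (snd v)))) (at (x, y, s))"
    \<comment> \<open>Division by 2 becomes multiplication by a constant, so that the product rule
      applies.\<close>
    unfolding hfield_Inl_quintic[abs_def] divide_inverse
    by (rule has_derivative_eq_rhs,
        (rule has_derivative_const has_derivative_coords has_derivative_quintic_x
        has_derivative_quintic_s has_derivative_add has_derivative_diff
        has_derivative_mult has_derivative_power)+,
        rule ext, simp add: a_def b_def R_def field_simps eval_nat_numeral)
  from hfield_Inl_eq[OF this, of i] show ?thesis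
    by (auto simp: axis_nth_if inner_axis a_def b_def field_simps eval_nat_numeral)
qed

lemma hfield_Inr_hfield_Inr_quintic:
  fixes k i :: "'n::finite" and x y :: "real^'n"
  defines "a \<equiv> x $ k" and "b \<equiv> y $ k"
  shows "hfield (Inr i) (hfield (Inr i) (quintic k)) (x, y, s)
    = of_bool (i = k) * (2 * a - (20/3) * a^3) + (2/3) * a^3 - 2 * a * (x $ i)^2"
proof -
  have "(hfield (Inr i) (quintic k) has_derivative
     (\<lambda>v. of_bool (i = k) * ((- 8 * s * a - 8 * a^2 * b) * fst v $ k
          - (8/3) * a^3 * fst (snd v) $ k + (2 - 4 * a^2) * snd (snd v))
        + 2 * a^2 * y $ i * fst v $ k + (2/3) * a^3 * fst (snd v) $ i
        + (1/2) * fst v $ i * quintic_s k (x, y, s)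
        + x $ i / 2 * ((- 8 * s - 8 * a * b) * fst v $ k + (2 - 4 * a^2) * fst (snd v) $ k
          - 8 * a * snd (snd v)))) (at (x, y, s))"
    unfolding hfield_Inr_quintic[abs_def] divide_inverse
    by (rule has_derivative_eq_rhs,
        (rule has_derivative_const has_derivative_coords has_derivative_quintic_y
        has_derivative_quintic_s has_derivative_add has_derivative_diff
        has_derivative_mult has_derivative_power)+,
        rule ext, simp add: a_def b_def field_simps eval_nat_numeral)
  from hfield_Inr_eq[OF this, of i] show ?thesis
    by (auto simp: axis_nth_if inner_axis a_def b_def field_simps eval_nat_numeral)
qed

section \<open>Harmonicity and the carre du champ\<close>

lemma sum_of_bool_eq: "(\<Sum>i\<in>UNIV. of_bool (i = k) * g i) = (g k :: real)" for k :: "'n::finite"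
  by (subst sum.remove[of _ k]) auto

lemma inner_eq_sum_squares: "x \<bullet> x = (\<Sum>i\<in>UNIV. (x $ i)^2)" for x :: "real^'n"
  by (simp add: inner_vec_def power2_eq_square)

text \<open>With \<open>a = x $ k\<close>, the parts for \<open>i = k\<close> of both fields add up
  to \<open>2*R*a - (4*n/3)*a^3\<close>; the remaining parts, summed over \<open>i\<close>, give
  exactly the opposite.\<close>

lemma hlaplacian_quintic: "hlaplacian (quintic k) p = 0"
proof -
  obtain x y s where p: "p = (x, y, s)" by (cases p)
  show ?thesis
    unfolding hlaplacian_def sum_UNIV_Plus p hfield_Inl_hfield_Inl_quintic
      hfield_Inr_hfield_Inr_quintic sum.distrib sum_subtractf sum_of_bool_eq inner_eq_sum_squares
      sum_distrib_left[symmetric] sum_constant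
    by (simp add: field_simps eval_nat_numeral)
qed

text \<open>The horizontal gradient is a vector in the \<open>k\<close>-th plane plus
  \<open>(2/3)*a^3\<close> times \<open>(x, y)\<close> plus \<open>C/2\<close> times
  \<open>(-y, x)\<close>. The last two vectors are orthogonal and of equal length in every
  coordinate plane, so the other planes, with total squared length \<open>w\<close>, contribute no
  cross term.\<close>

lemma carre_du_champ_quintic:
  fixes k :: "'n::finite" and x y :: "real^'n"
  defines "a \<equiv> x $ k" and "b \<equiv> y $ k" and "w \<equiv> x \<bullet> x + y \<bullet> y - (x $ k)^2 - (y $ k)^2"
  shows "carre_du_champ (quintic k) (x, y, s)
    = (1 - a^2 - b^2 - 4 * s^2 - 4 * s * a * b - a^2 * b^2 + w * a^2
         + ((7 - real CARD('n)) / 3) * a^4)^2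
      + ((2 * s + a * b) * (1 - 4 * a^2))^2
      + w * ((b - 2 * a * (2 * s + a * b))^2 + (4/9) * a^6)"
proof -
  define A B C where "A = quintic_x k (x, y, s)" and "B = quintic_y k (x, y, s)"
    and "C = quintic_s k (x, y, s)"
  have "carre_du_champ (quintic k) (x, y, s)
    = (\<Sum>i\<in>UNIV. of_bool (i = k) * (A^2 + 2 * A * ((2/3) * a^3 * x $ i - y $ i / 2 * C)
         + B^2 + 2 * B * ((2/3) * a^3 * y $ i + x $ i / 2 * C))
       + (4/9 * a^6 + C^2 / 4) * ((x $ i)^2 + (y $ i)^2))"
    unfolding carre_du_champ_def sum_UNIV_Plus hfield_Inl_quintic hfield_Inr_quintic
      sum.distrib[symmetric]
    by (intro sum.cong refl)
      (auto simp: A_def B_def C_def a_def field_simps eval_nat_numeral)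
  also have "\<dots> = A^2 + 2 * A * ((2/3) * a^3 * a - b / 2 * C)
         + B^2 + 2 * B * ((2/3) * a^3 * b + a / 2 * C)
       + (4/9 * a^6 + C^2 / 4) * (w + a^2 + b^2)"
    unfolding sum.distrib sum_of_bool_eq sum_distrib_left[symmetric]
    by (simp add: a_def b_def w_def inner_eq_sum_squares)
  also have "\<dots> = (A + (2/3) * a^4 - b / 2 * C)^2 + (B + (2/3) * a^3 * b + a / 2 * C)^2
       + w * ((C / 2)^2 + (4/9) * a^6)"
    by (simp add: field_simps eval_nat_numeral)
  also have "A + (2/3) * a^4 - b / 2 * C
      = 1 - a^2 - b^2 - 4 * s^2 - 4 * s * a * b - a^2 * b^2 + w * a^2
         + ((7 - real CARD('n)) / 3) * a^4"
    by (simp add: A_def C_def quintic_x_def quintic_s_def Let_def a_def b_def w_def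
        field_simps eval_nat_numeral)
  also have "B + (2/3) * a^3 * b + a / 2 * C = (2 * s + a * b) * (1 - 4 * a^2)"
    by (simp add: B_def C_def quintic_y_def quintic_s_def Let_def a_def b_def
        field_simps eval_nat_numeral)
  also have "C / 2 = b - 2 * a * (2 * s + a * b)"
    by (simp add: C_def quintic_s_def Let_def a_def b_def field_simps eval_nat_numeral)
  finally show ?thesis .
qed

section \<open>Small balls\<close>

text \<open>The minimum of \<open>\<rho>\<close> over the compact Euclidean sphere is positive and
  serves as \<open>r\<close>.\<close>

lemma heis_ball_subset_ball:
  assumes "homogeneous_norm \<rho>" and "\<epsilon> > 0"
  obtains r where "r > 0" and "heis_ball \<rho> r \<subseteq> ball 0 \<epsilon>"
proof -
  note h = assms(1)[unfolded homogeneous_norm_def]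
  have "sphere (0 :: 'a heis) \<epsilon> \<noteq> {}"
    using assms(2) by (simp add: sphere_eq_empty)
  moreover have "continuous_on (sphere 0 \<epsilon>) \<rho>"
    using h continuous_on_subset by blast
  ultimately obtain q where q: "q \<in> sphere 0 \<epsilon>" "\<And>p. p \<in> sphere 0 \<epsilon> \<Longrightarrow> \<rho> q \<le> \<rho> p"
    using continuous_attains_inf[of "sphere 0 \<epsilon>" \<rho>] by auto
  have "q \<noteq> heis_e"
    using q(1) assms(2) by (auto simp: heis_e_def zero_prod_def[symmetric])
  then have pos: "\<rho> q > 0"
    using h by (metis less_eq_real_def)
  have "p \<in> ball 0 \<epsilon>" if p: "\<rho> p < \<rho> q" for p
  proof (rule ccontr)
    assume "p \<notin> ball 0 \<epsilon>"
    \<comment> \<open>The curve of dilates of \<open>p\<close> runs from the origin at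
      \<open>l = 0\<close> to \<open>p\<close> at \<open>l = 1\<close>, so it meets the sphere,
      where \<open>\<rho>\<close> would be below its minimum.\<close>
    then have "\<epsilon> \<le> norm (heis_dilation 1 p)"
      by (cases p) (simp add: heis_dilation_def)
    moreover have "norm (heis_dilation 0 p) \<le> \<epsilon>"
      using assms(2) by (cases p) (simp add: heis_dilation_def zero_prod_def[symmetric])
    moreover have "continuous_on {0..1} (\<lambda>l. norm (heis_dilation l p))"
      by (cases p) (simp add: heis_dilation_def, intro continuous_intros)
    ultimately obtain l where l: "0 \<le> l" "l \<le> 1" "norm (heis_dilation l p) = \<epsilon>"
      using IVT'[of "\<lambda>l. norm (heis_dilation l p)" 0 \<epsilon> 1] by auto
    \<comment> \<open>Homogeneity is available for positive factors only.\<close>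
    have "l \<noteq> 0"
      using l(3) assms(2) by (cases p) (auto simp: heis_dilation_def zero_prod_def[symmetric])
    then have "\<rho> (heis_dilation l p) = l * \<rho> p"
      using h l(1) by (metis less_eq_real_def)
    also have "\<dots> \<le> \<rho> p"
      using l mult_right_mono[of l 1 "\<rho> p"] h by (metis mult_1)
    also have "\<dots> < \<rho> (heis_dilation l p)"
      using p q(2)[of "heis_dilation l p"] l(3) by simp
    finally show False by simp
  qed
  then show ?thesis
    using that[OF pos] unfolding heis_ball_def by blast
qed

section \<open>Non-linearity\<close>

text \<open>On \<open>x = 0\<close> the polynomial is \<open>2*s*y\<close>. Two points with the same
  horizontal part \<open>(0, l e_k)\<close> and heights \<open>l^2\<close> and \<open>0\<close> give
  the values \<open>2*l^3\<close> and \<open>0\<close>.\<close>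

lemma quintic_not_linear:
  assumes "homogeneous_norm \<rho>" and "r > 0"
  shows "\<not> heis_linear_on (heis_ball \<rho> r) (quintic k)"
proof
  assume "heis_linear_on (heis_ball \<rho> r) (quintic k)"
  then obtain \<alpha> \<omega> where lin: "\<And>x y s. (x, y, s) \<in> heis_ball \<rho> r
      \<Longrightarrow> quintic k (x, y, s) = \<alpha> + \<omega> \<bullet> (x, y)"
    unfolding heis_linear_on_def by blast
  have small: "\<exists>m>0. \<forall>l. 0 < l \<and> l < m \<longrightarrow> heis_dilation l p \<in> heis_ball \<rho> r" for p
  \<comment> \<open>The summand 1 keeps the denominator positive even where
    \<open>\<rho> p = 0\<close>.\<close>
  proof (intro exI[of _ "r / (\<rho> p + 1)"] conjI allI impI)
    have nn: "0 \<le> \<rho> p"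
      using assms(1) unfolding homogeneous_norm_def by blast
    then show "0 < r / (\<rho> p + 1)"
      using assms(2) by simp
    fix l assume l: "0 < l \<and> l < r / (\<rho> p + 1)"
    then have "l * \<rho> p + l < r"
      using nn by (simp add: field_simps)
    moreover have "\<rho> (heis_dilation l p) = l * \<rho> p"
      using assms(1) l unfolding homogeneous_norm_def by blast
    ultimately show "heis_dilation l p \<in> heis_ball \<rho> r"
      using l by (simp add: heis_ball_def)
  qed
  obtain m m' where "m > 0" "\<And>l. 0 < l \<Longrightarrow> l < m \<Longrightarrow> heis_dilation l (0, axis k 1, 1) \<in> heis_ball \<rho> r"
    and "m' > 0" "\<And>l. 0 < l \<Longrightarrow> l < m' \<Longrightarrow> heis_dilation l (0, axis k 1, 0) \<in> heis_ball \<rho> r"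
    using small by metis
  moreover obtain l where "0 < l" "l < m" "l < m'"
    using \<open>m > 0\<close> \<open>m' > 0\<close> field_lbound_gt_zero by blast
  ultimately have "(0, l *\<^sub>R axis k 1, l\<^sup>2) \<in> heis_ball \<rho> r" "(0, l *\<^sub>R axis k 1, 0) \<in> heis_ball \<rho> r"
    by (fastforce simp: heis_dilation_def)+
  from lin[OF this(1)] lin[OF this(2)]
  have "quintic k (0, l *\<^sub>R axis k 1, l\<^sup>2) = quintic k (0, l *\<^sub>R axis k 1, 0)"
    by simp
  then show False
    using \<open>0 < l\<close> by (simp add: quintic_def axis_nth_if)
qed

section \<open>The carre du champ near the identity\<close>

lemma carre_du_champ_estimate:
  fixes a b s w N :: real
  assumes "a^2 \<le> 1/100" "b^2 \<le> 1/100" "s^2 \<le> 1/100" "0 \<le> w" "w \<le> 1/100"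
    and "0 \<le> N" "N * a^2 \<le> 1"
  shows "(1 - a^2 - b^2 - 4 * s^2 - 4 * s * a * b - a^2 * b^2 + w * a^2 + ((7 - N) / 3) * a^4)^2
      + ((2 * s + a * b) * (1 - 4 * a^2))^2
      + w * ((b - 2 * a * (2 * s + a * b))^2 + (4/9) * a^6) \<le> 1"
proof -
  define A where "A = - (a^2) - b^2 - 4 * s^2 - 4 * s * a * b - a^2 * b^2 + w * a^2
    + ((7 - N) / 3) * a^4"
  define u where "u = 2 * s + a * b"
  have sab: "s * a * b \<le> (a^2 + b^2) / 20" "- (s * a * b) \<le> (a^2 + b^2) / 20"
  proof -
    have "\<bar>s\<bar> \<le> 1/10"
      using assms(3) abs_le_square_iff[of s "1/10"] by (simp add: power2_eq_square)
    moreover have "\<bar>a * b\<bar> \<le> (a^2 + b^2) / 2"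
      using sum_squares_bound[of a b] sum_squares_bound[of a "-b"] by (auto simp: abs_if)
    ultimately have "\<bar>s\<bar> * \<bar>a * b\<bar> \<le> 1/10 * ((a^2 + b^2) / 2)"
      by (intro mult_mono) auto
    then have "\<bar>s * a * b\<bar> \<le> (a^2 + b^2) / 20" by (simp add: abs_mult mult.assoc)
    then show "s * a * b \<le> (a^2 + b^2) / 20" "- (s * a * b) \<le> (a^2 + b^2) / 20" by linarith+
  qed
  have ab: "0 \<le> a^2 * b^2" "a^2 * b^2 \<le> a^2 / 100"
    using mult_left_mono[OF assms(2), of "a^2"] by auto
  have wa: "0 \<le> w * a^2" "w * a^2 \<le> a^2 / 100"
    using mult_right_mono[OF assms(5), of "a^2"] assms(4) by auto
  have a4_eq: "a^4 = a^2 * a^2"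
    by (simp add: power2_eq_square power4_eq_xxxx)
  have a4: "0 \<le> a^4" "a^4 \<le> a^2 / 100"
    using mult_left_mono[OF assms(1), of "a^2"] unfolding a4_eq by simp_all
  have Na: "0 \<le> N * a^4" "N * a^4 \<le> a^2"
    using mult_right_mono[OF assms(7), of "a^2"] assms(6) unfolding a4_eq
    by (simp_all add: mult.assoc)
  have A_eq: "A = - (a^2) - b^2 - 4 * s^2 - 4 * (s * a * b) - a^2 * b^2 + w * a^2
    + 7/3 * a^4 - 1/3 * (N * a^4)"
    unfolding A_def by (simp add: field_simps)
  note bounds = sab ab wa a4 Na assms(1-3) zero_le_power2[of a] zero_le_power2[of b]
    zero_le_power2[of s]
  have A_le: "A \<le> - (3/4) * (a^2 + b^2) - 4 * s^2"
    using A_eq bounds by argo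
  \<comment> \<open>The bound \<open>N * a^2 \<le> 1\<close> enters here, controlling the negative
    term \<open>-(1/3)*N*a^4\<close> uniformly in \<open>N\<close>.\<close>
  have A_ge: "- (1/2) \<le> A"
    using A_eq bounds by argo
  have "A \<le> 0"
    using A_le zero_le_power2[of a] zero_le_power2[of b] zero_le_power2[of s] by argo
  \<comment> \<open>For \<open>A\<close> between \<open>-1/2\<close> and \<open>0\<close> one has
    \<open>A^2 \<le> -A/2\<close>, which makes the bound on \<open>(1 + A)^2\<close> linear in
    \<open>A\<close>.\<close>
  then have "A * (A + 1/2) \<le> 0"
    using A_ge by (intro mult_nonpos_nonneg) auto
  then have first: "(1 + A)^2 \<le> 1 + 3/2 * A"
    by (simp add: power2_eq_square algebra_simps)
  have u_eq: "u^2 = 4 * s^2 + 4 * (s * a * b) + a^2 * b^2"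
    by (simp add: u_def power2_eq_square algebra_simps)
  then have u: "u^2 \<le> 1/10"
    using sab ab assms(1-3) by argo
  have "(1 - 4 * a^2)^2 \<le> 1"
    using assms(1) by (intro power_le_one) auto
  then have second: "(u * (1 - 4 * a^2))^2 \<le> u^2"
    by (simp add: power_mult_distrib mult_left_le)
  have "(b - 2 * a * u)^2 \<le> 2 * b^2 + 8 * (a^2 * u^2)"
    using zero_le_power2[of "b + 2 * a * u"] by (simp add: power2_eq_square algebra_simps)
  moreover have "a^2 * u^2 \<le> a^2 / 10"
    using mult_left_mono[OF u, of "a^2"] by auto
  moreover have "a^6 \<le> a^2"
    using assms(1) power_decreasing[of 1 3 "a^2"] by (simp flip: power_mult)
  ultimately have "(b - 2 * a * u)^2 + (4/9) * a^6 \<le> 2 * (a^2 + b^2)"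
    using zero_le_power2[of a] by argo
  then have "w * ((b - 2 * a * u)^2 + (4/9) * a^6) \<le> 1/100 * (2 * (a^2 + b^2))"
    using assms(4,5) by (intro mult_mono) auto
  \<comment> \<open>The first square leaves a gain of \<open>(9/8)*(a^2 + b^2) + 6*s^2\<close>. The
    second costs at most \<open>4*s^2 + (a^2 + b^2)/5 + a^2/100\<close>, the last term
    \<open>(a^2 + b^2)/50\<close>.\<close>
  with first second have "(1 + A)^2 + (u * (1 - 4 * a^2))^2
      + w * ((b - 2 * a * u)^2 + (4/9) * a^6) \<le> 1"
    using A_le u_eq sab ab zero_le_power2[of a] zero_le_power2[of b] zero_le_power2[of s] by argo
  then show ?thesis
    by (simp add: A_def u_def algebra_simps)
qed

text \<open>The radius shrinks with \<open>n\<close> so that \<open>n * (x $ k)^2\<close> stays at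
  most 1, as the coefficient \<open>(7 - n)/3\<close> of the fourth power demands.\<close>

lemma carre_du_champ_quintic_le_1:
  fixes k :: "'n::finite"
  assumes "p \<in> ball 0 (1 / (10 * real CARD('n)))"
  shows "carre_du_champ (quintic k) p \<le> 1"
proof -
  obtain x y s where p: "p = (x, y, s)" by (cases p)
  define N where "N = real CARD('n)"
  have N: "1 \<le> N"
    by (simp add: N_def Suc_leI)
  have "(norm p)^2 \<le> (1 / (10 * N))^2"
    using assms by (intro power_mono) (auto simp: N_def)
  then have small: "x \<bullet> x + y \<bullet> y + s^2 \<le> 1 / (100 * N^2)"
    by (simp add: p norm_prod_def dot_square_norm power_mult_distrib power_divide)
  also have "\<dots> \<le> 1/100"
    using N by (simp add: field_simps)
  finally have small': "x \<bullet> x + y \<bullet> y + s^2 \<le> 1/100" .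
  have "(x $ k)^2 \<le> x \<bullet> x" "(y $ k)^2 \<le> y \<bullet> y"
    unfolding inner_eq_sum_squares by (auto intro: member_le_sum)
  note k = this zero_le_power2[of s] inner_ge_zero[of x] inner_ge_zero[of y]
    zero_le_power2[of "x $ k"] zero_le_power2[of "y $ k"]
  have "N * (x $ k)^2 \<le> N * (1 / (100 * N^2))"
    using small k N by (intro mult_left_mono) linarith+
  also have "\<dots> \<le> 1"
    using N by (simp add: field_simps power2_eq_square)
  finally have "N * (x $ k)^2 \<le> 1" .
  then show ?thesis
    unfolding p carre_du_champ_quintic N_def[symmetric]
    using k small' N by (intro carre_du_champ_estimate) linarith+
qed

theorem proposition1p2:
  fixes \<rho> :: "'n::finite heis \<Rightarrow> real"
  assumes "homogeneous_norm \<rho>"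
  shows "\<exists>r>0. \<exists>f :: 'n heis \<Rightarrow> real.
           Ck_on 2 f (heis_ball \<rho> r) \<and>
           \<not> heis_linear_on (heis_ball \<rho> r) f \<and>
           (\<forall>p\<in>heis_ball \<rho> r. hlaplacian f p = 0) \<and>
           carre_du_champ f heis_e = 1 \<and>
           (\<forall>p\<in>heis_ball \<rho> r. carre_du_champ f p \<le> 1)"
proof -
  obtain r where r: "r > 0" "heis_ball \<rho> r \<subseteq> ball 0 (1 / (10 * real CARD('n)))"
    using heis_ball_subset_ball[OF assms, of "1 / (10 * real CARD('n))"] by auto
  \<comment> \<open>Any coordinate pair will do; one exists because types are nonempty, which is the
    condition that \<open>n\<close> be at least 1.\<close>
  obtain k :: 'n where True by simp
  have "carre_du_champ (quintic k) heis_e = 1"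
    by (simp add: heis_e_def carre_du_champ_quintic)
  moreover have "Ck_on 2 (quintic k) (heis_ball \<rho> r)"
    using Ck_on_mono[OF Ck_on_quintic] by blast
  ultimately show ?thesis
    using r quintic_not_linear[OF assms r(1), of k] hlaplacian_quintic[of k]
      carre_du_champ_quintic_le_1[of _ k] by blast
qed

end
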